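(* Let $d\geq 3$, $r>0$, and let $P,Q$ be two convex polytopes contained in the interior of the ball $r\mathbf{B}^{d}$. Assume that for every point $z$ on the sphere $rS^{d-1}=\partial(r\mathbf{B}^d)$ the spherical projections $P_z$ and $Q_z$ are congruent, i.e. there exists $\varphi_z\in O(d)$ with $\varphi_z(P_z)=Q_z$. Then $P=Q$.
   Context: $\mathbb{E}^d$ denotes $d$-dimensional Euclidean space with norm $|\cdot|$, $r\mathbf{B}^d=\{x\in\mathbb{E}^d: |x|\le r\}$, and $rS^{d-1}=\{x\in\mathbb{E}^d: |x|=r\}$; $O(d)$ is the orthogonal group. A convex polytope $P\subset\mathbb{E}^d$ is a convex body (compact convex set with non-empty interior) that is the convex hull of finitely many points. For points $x,y\in\mathbb{E}^d$, $xy=\{tx+(1-t)y: t\in[0,1]\}$ is the closed segment joining them. For a body $K$ contained in the interior of $r\mathbf{B}^d$ and $z\in rS^{d-1}$, the spherical projection of $K$ from $z$ is $$K_z=\{x\in rS^{d-1}: xz\cap K\neq\emptyset\}.$$ Two subsets $A,B\subset rS^{d-1}$ are congruent if there exists an orthogonal transformation $\varphi\in O(d)$ such that $\varphi(A)=B$. *)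

theory Defs
  imports "HOL-Analysis.Analysis"
begin

(* The library's polytope predicate (convex hull of a finite set) also admits the empty set
   and lower-dimensional hulls; a convex body has non-empty interior.
   Compactness and convexity follow from polytope. *)
definition convex_polytope :: "'a::euclidean_space set \<Rightarrow> bool" where
  "convex_polytope P \<longleftrightarrow> polytope P \<and> interior P \<noteq> {}"

definition spherical_projection :: "real \<Rightarrow> 'a::euclidean_space set \<Rightarrow> 'a \<Rightarrow> 'a set" where
  "spherical_projection r K z = {x \<in> sphere 0 r. closed_segment x z \<inter> K \<noteq> {}}"

(* Only linear isometries are allowed: no translations, but reflections are included. *)
definition congruent_sets :: "'a::euclidean_space set \<Rightarrow> 'a set \<Rightarrow> bool" where
  "congruent_sets A B \<longleftrightarrow> (\<exists>\<phi>. orthogonal_transformation \<phi> \<and> \<phi> ` A = B)"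

end

theory Submission
  imports Defs "HOL-Computational_Algebra.Polynomial"
begin

text \<open>
  The projection of a polytope \<open>Q\<close> from \<open>z\<close> determines \<open>z\<close>: if it were also the projection of a convex
  body from \<open>z' \<noteq> z\<close>, take a facet of the cone over \<open>Q\<close> with apex \<open>z\<close> that has \<open>z'\<close> strictly on its inner
  side, and two points of the projection on it (here \<open>d \<ge> 3\<close> is used). The ray from \<open>z'\<close> through
  their midpoint meets the sphere outside the cone, a contradiction. Hence \<open>\<phi>\<^sub>z\<close> fixes \<open>z\<close> and maps the cone
  over \<open>P\<close> to the cone over \<open>Q\<close>, extreme rays to extreme rays. For a vertex \<open>v\<close> of \<open>P\<close> and all \<open>z\<close> in a
  nonempty open subset of the sphere, \<open>v\<close> spans an extreme ray, so some vertex \<open>w\<close> of \<open>Q\<close> is seen from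
  \<open>z\<close> at the same angle to the centre as \<open>v\<close>. By finiteness a single \<open>w\<close> works on an open set, the
  equality of angles being algebraic it holds on the whole sphere, and this forces \<open>v = w\<close>.
\<close>

section \<open>Orthogonal vectors, chords of the sphere and rays of a spherical projection\<close>

lemma unit_orthogonal_to_pair:
  fixes v w :: "'a::euclidean_space"
  assumes "DIM('a) \<ge> 3"
  obtains e where "norm e = 1" "e \<bullet> v = 0" "e \<bullet> w = 0"
proof -
  have "dim (span {v, w}) \<le> card {v, w}"
    by (simp add: dim_le_card')
  also have "\<dots> \<le> 2" by (simp add: card_insert_if)
  finally have "span {v, w} \<noteq> UNIV"
    using assms dim_span[of "{v, w}"] dim_UNIV[where 'a='a] by force
  then obtain a where "a \<noteq> 0" and a: "\<And>x. x \<in> span {v, w} \<Longrightarrow> a \<bullet> x = 0"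
    by (metis span_not_UNIV_orthogonal)
  show ?thesis
  proof
    show "norm (a /\<^sub>R norm a) = 1" using \<open>a \<noteq> 0\<close> by simp
  qed (use a[of v] a[of w] in \<open>auto simp: span_base\<close>)
qed

lemma chord_beyond:
  fixes p z :: "'a::euclidean_space"
  assumes "norm p < r" "norm z = r"
  obtains t where "t > 0" "p + t *\<^sub>R (p - z) \<in> sphere 0 r"
proof -
  have "p - z \<noteq> 0" using assms by auto
  then obtain d where "0 < d" "p + d *\<^sub>R (p - z) \<in> frontier (cball 0 r)"
    using ray_to_frontier[of "cball 0 r" p "p - z"] assms(1)
    by (auto simp: interior_cball)
  then show ?thesis using that by (simp add: frontier_cball)
qed

lemma ray_hits_spherical_projection:
  fixes K :: "'a::euclidean_space set"
  assumes "K \<subseteq> ball 0 r" "norm z = r" "q \<in> K"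
  obtains t where "t > 1" "z + t *\<^sub>R (q - z) \<in> spherical_projection r K z"
proof -
  obtain t where t: "t > 0" "q + t *\<^sub>R (q - z) \<in> sphere 0 r"
    using chord_beyond[of q r z] assms by (auto simp: subset_iff)
  define x where "x = q + t *\<^sub>R (q - z)"
  have "q = (1 - t / (1 + t)) *\<^sub>R x + (t / (1 + t)) *\<^sub>R z"
  proof -
    have "(1 + t) *\<^sub>R q = (1 + t) *\<^sub>R ((1 - t / (1 + t)) *\<^sub>R x + (t / (1 + t)) *\<^sub>R z)"
      using t(1) by (simp add: x_def algebra_simps divide_simps)
    then show ?thesis using t(1) by simp
  qed
  moreover have "0 \<le> t / (1 + t)" "t / (1 + t) \<le> 1" using t(1) by auto
  ultimately have "q \<in> closed_segment x z"
    unfolding closed_segment_def by blast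
  then have "x \<in> spherical_projection r K z"
    using t(2) assms(3) by (auto simp: spherical_projection_def x_def)
  moreover have "x = z + (1 + t) *\<^sub>R (q - z)" by (simp add: x_def algebra_simps)
  ultimately show ?thesis using that[of "1 + t"] t(1) by simp
qed

lemma spherical_projection_ray:
  assumes "K \<subseteq> ball 0 r" "norm z = r" "x \<in> spherical_projection r K z"
  obtains q s where "q \<in> K" "0 < s" "s \<le> 1" "q = z + s *\<^sub>R (x - z)"
proof -
  from assms(3) obtain q where q: "q \<in> K" "q \<in> closed_segment x z"
    by (auto simp: spherical_projection_def)
  then obtain u where u: "0 \<le> u" "u \<le> 1" "q = (1 - u) *\<^sub>R x + u *\<^sub>R z"
    by (auto simp: closed_segment_def)
  have "q \<noteq> z" using q assms(1,2) by auto
  then have "u \<noteq> 1" using u by auto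
  then show ?thesis using that[of q "1 - u"] q u by (simp add: algebra_simps)
qed

text \<open>A point of the projection records only that its ray from \<open>z\<close> meets the
  body. An inclusion of projections therefore amounts to an inclusion of cones with apex
  \<open>z\<close>.\<close>

lemma same_projection_same_rays:
  fixes M Q :: "'a::euclidean_space set"
  assumes "M \<subseteq> ball 0 r" "Q \<subseteq> ball 0 r" "norm z = r"
    and "spherical_projection r Q z \<subseteq> spherical_projection r M z" and "q \<in> Q"
  obtains m \<alpha> where "m \<in> M" "\<alpha> > 0" "m - z = \<alpha> *\<^sub>R (q - z)"
proof -
  obtain t where t: "t > 1" "z + t *\<^sub>R (q - z) \<in> spherical_projection r Q z"
    using ray_hits_spherical_projection[OF assms(2,3,5)] .
  then have "z + t *\<^sub>R (q - z) \<in> spherical_projection r M z" using assms(4) by auto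
  from spherical_projection_ray[OF assms(1,3) this]
  obtain m s where m: "m \<in> M" "0 < s" "m = z + s *\<^sub>R ((z + t *\<^sub>R (q - z)) - z)" by metis
  show ?thesis
    by (rule that[of m "s * t"]) (use m t in auto)
qed

section \<open>The projection determines its apex\<close>

text \<open>The facets through \<open>z\<close> of \<open>T\<close>, the hull of \<open>Q\<close>
  and \<open>z\<close>, bound the cone over \<open>Q\<close> with apex \<open>z\<close>. Moving from
  \<open>z\<close> directly away from \<open>z'\<close> leaves the ball and hence \<open>T\<close>,
  so some inequality that is tight at \<open>z\<close> is violated at once; its hyperplane has
  \<open>z'\<close> strictly on the inner side.\<close>

lemma cone_facet_facing:
  fixes Q :: "'a::euclidean_space set"
  assumes dim: "DIM('a) \<ge> 3" and Q: "convex_polytope Q" "Q \<subseteq> ball 0 r"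
    and z: "norm z = r" "norm z' = r" "z \<noteq> z'"
  obtains a q1 q2 where "\<And>q. q \<in> Q \<Longrightarrow> a \<bullet> q \<le> a \<bullet> z" "a \<bullet> z' < a \<bullet> z"
    "q1 \<in> Q" "q2 \<in> Q" "a \<bullet> q1 = a \<bullet> z" "a \<bullet> q2 = a \<bullet> z" "\<not> collinear {z, q1, q2}"
proof -
  obtain V where V: "finite V" "Q = convex hull V" using Q(1) unfolding convex_polytope_def polytope_def by auto
  have VQ: "V \<subseteq> Q" using V(2) by (simp add: hull_subset)
  define T where "T = convex hull (insert z V)"
  have "polyhedron T" unfolding T_def using V(1) by (simp add: polyhedron_convex_hull)
  have QT: "Q \<subseteq> T" unfolding V T_def by (intro hull_mono) auto
  have zT: "z \<in> T" unfolding T_def by (simp add: hull_inc)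
  have intT: "interior T \<noteq> {}"
    using Q(1) interior_mono[OF QT] by (auto simp: convex_polytope_def)
  have affT: "affine hull T = UNIV" "aff_dim T = DIM('a)"
    using intT by (simp_all add: affine_hull_nonempty_interior aff_dim_nonempty_interior)
  have Tball: "T \<subseteq> cball 0 r"
    unfolding T_def
  proof (rule hull_minimal)
    show "insert z V \<subseteq> cball 0 r" using VQ Q(2) z by auto
  qed simp
  \<comment> \<open>A minimal system of half-spaces is taken so that each bounding hyperplane cuts
    out a facet of \<open>T\<close>, not merely a face.\<close>
  obtain F where F: "finite F" "T = affine hull T \<inter> \<Inter>F"
    and Fab: "\<forall>h \<in> F. \<exists>a b. a \<noteq> 0 \<and> h = {x. a \<bullet> x \<le> b}"
    and Fmin: "\<forall>F'. F' \<subset> F \<longrightarrow> T \<subset> affine hull T \<inter> \<Inter>F'"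
    using \<open>polyhedron T\<close> unfolding polyhedron_Int_affine_minimal by metis
  from Fab obtain a b where ab: "\<And>h. h \<in> F \<Longrightarrow> a h \<noteq> 0 \<and> h = {x. a h \<bullet> x \<le> b h}" by metis
  have TF: "a h \<bullet> x \<le> b h" if "h \<in> F" "x \<in> T" for h x
    using F(2) that ab by blast
  define u where "u = z' - z"
  have zz: "z \<bullet> z = r\<^sup>2" using z by (simp add: dot_square_norm)
  have "z \<bullet> u < 0"
  proof -
    have "(norm (z' - z))\<^sup>2 = 2 * r\<^sup>2 - 2 * (z \<bullet> z')"
      using z by (simp add: dot_norm_neg[of z' z] dist_norm norm_minus_commute field_simps inner_commute[of z z'])
    moreover have "(norm (z' - z))\<^sup>2 > 0" using z by simp
    moreover have "z \<bullet> z = r\<^sup>2" using z by (simp add: dot_square_norm)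
    ultimately show ?thesis by (simp add: u_def inner_diff)
  qed
  have out: "z - \<epsilon> *\<^sub>R u \<notin> T" if "\<epsilon> > 0" for \<epsilon>
  proof -
    have "(norm (z - \<epsilon> *\<^sub>R u))\<^sup>2 = r\<^sup>2 - 2 * \<epsilon> * (z \<bullet> u) + (\<epsilon> * norm u)\<^sup>2"
      using z by (simp add: power2_norm_eq_inner inner_diff inner_commute algebra_simps power_mult_distrib)
        (simp add: power2_norm_eq_inner zz power_mult_distrib power2_eq_square[of \<epsilon>])
    moreover have "\<epsilon> * (z \<bullet> u) < 0" using that \<open>z \<bullet> u < 0\<close> by (simp add: mult_pos_neg)
    ultimately have "(norm (z - \<epsilon> *\<^sub>R u))\<^sup>2 > r\<^sup>2"
      using zero_le_power2[of "\<epsilon> * norm u"] by linarith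
    then have "norm (z - \<epsilon> *\<^sub>R u) > r" by (rule power2_less_imp_less) simp
    then show ?thesis using Tball by auto
  qed
  have "\<exists>h\<in>F. a h \<bullet> z = b h \<and> a h \<bullet> u < 0"
  proof (rule ccontr)
    assume "\<not> ?thesis"
    then have neg: "\<And>h. h \<in> F \<Longrightarrow> a h \<bullet> z = b h \<Longrightarrow> a h \<bullet> u \<ge> 0" by force
    \<comment> \<open>Were there no such half-space, small steps against \<open>u\<close> would stay
      in \<open>T\<close>: the tight constraints do not increase, and the slack ones survive by
      continuity.\<close>
    have "\<forall>\<^sub>F \<epsilon> in at_right 0. \<forall>h\<in>F. a h \<bullet> (z - \<epsilon> *\<^sub>R u) \<le> b h"
    proof (rule eventually_ball_finite[OF F(1)], rule ballI)
      fix h assume h: "h \<in> F"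
      show "\<forall>\<^sub>F \<epsilon> in at_right 0. a h \<bullet> (z - \<epsilon> *\<^sub>R u) \<le> b h"
      proof (cases "a h \<bullet> z = b h")
        case True
        then show ?thesis using neg[OF h True]
          by (auto simp: eventually_at_right_less inner_diff_right intro!: eventually_mono[OF eventually_at_right_less[of "0::real"]])
      next
        case False
        then have "a h \<bullet> z < b h" using TF[OF h zT] by simp
        moreover have "((\<lambda>\<epsilon>. a h \<bullet> (z - \<epsilon> *\<^sub>R u)) \<longlongrightarrow> a h \<bullet> (z - 0 *\<^sub>R u)) (at_right 0)"
          by (intro tendsto_intros)
        ultimately have "\<forall>\<^sub>F \<epsilon> in at_right 0. a h \<bullet> (z - \<epsilon> *\<^sub>R u) < b h"
          by (intro order_tendstoD(2)) auto
        then show ?thesis by eventually_elim simp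
      qed
    qed
    then have "\<forall>\<^sub>F \<epsilon> in at_right 0. \<epsilon> > 0 \<and> (\<forall>h\<in>F. a h \<bullet> (z - \<epsilon> *\<^sub>R u) \<le> b h)"
      using eventually_at_right_less[of "0::real"] by eventually_elim auto
    then obtain \<epsilon> where "\<epsilon> > 0" "\<forall>h\<in>F. a h \<bullet> (z - \<epsilon> *\<^sub>R u) \<le> b h"
      using eventually_happens[of _ "at_right (0::real)"] by (auto simp: trivial_limit_at_right_real)
    then have "z - \<epsilon> *\<^sub>R u \<in> T" using F(2) ab affT by auto
    then show False using out \<open>\<epsilon> > 0\<close> by auto
  qed
  then obtain h where h: "h \<in> F" "a h \<bullet> z = b h" "a h \<bullet> u < 0" by auto
  define C where "C = T \<inter> {x. a h \<bullet> x = b h}"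
  have "C facet_of T"
    using facet_of_polyhedron_explicit[OF F ab, of C] Fmin h(1) unfolding C_def by blast
  then have C: "C face_of T" "aff_dim C = DIM('a) - 1"
    using affT by (auto simp: facet_of_def)
  obtain S where S: "S \<subseteq> insert z V" "C = convex hull S"
    using face_of_convex_hull_subset[of "insert z V" C] C(1) V(1)
    unfolding T_def by (metis finite.insertI finite_imp_compact)
  \<comment> \<open>\<open>C\<close> is the hull of \<open>S\<close> and has dimension at least 2,
    so \<open>S\<close> is contained neither in \<open>{z}\<close> nor in a line through
    \<open>z\<close>.\<close>
  have "\<not> S \<subseteq> {z}"
  proof
    assume "S \<subseteq> {z}"
    then have "aff_dim C \<le> 0"
      using aff_dim_subset[of S "{z}"] unfolding S(2) aff_dim_convex_hull by simp
    then show False using C(2) dim by linarith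
  qed
  then obtain q1 where q1: "q1 \<in> S" "q1 \<noteq> z" by auto
  have "\<not> S \<subseteq> affine hull {z, q1}"
  proof
    assume "S \<subseteq> affine hull {z, q1}"
    then have "aff_dim C \<le> aff_dim {z, q1}"
      using aff_dim_subset[of S "affine hull {z, q1}"] unfolding S(2) aff_dim_convex_hull by simp
    also have "\<dots> \<le> 1" using aff_dim_le_card[of "{z,q1}"] q1(2) by simp
    finally show False using C(2) dim by linarith
  qed
  then obtain q2 where q2: "q2 \<in> S" "q2 \<notin> affine hull {z, q1}" by auto
  have "q2 \<noteq> z" using q2(2) by (auto simp: hull_inc)
  have "S \<subseteq> C" using S(2) by (simp add: hull_subset)
  show ?thesis
  proof (rule that[of "a h" q1 q2])
    show "a h \<bullet> q \<le> a h \<bullet> z" if "q \<in> Q" for q using TF[OF h(1)] QT that h(2) by auto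
    show "a h \<bullet> z' < a h \<bullet> z" using h(3) by (simp add: u_def inner_diff_right)
    show "q1 \<in> Q" "q2 \<in> Q" using q1 q2 S(1) VQ \<open>q2 \<noteq> z\<close> by auto
    show "a h \<bullet> q1 = a h \<bullet> z" "a h \<bullet> q2 = a h \<bullet> z"
      using q1(1) q2(1) \<open>S \<subseteq> C\<close> h(2) by (auto simp: C_def)
    show "\<not> collinear {z, q1, q2}"
      using q2(2) q1(2) collinear_3_affine_hull[of z q1 q2] by auto
  qed
qed

text \<open>Two points \<open>x\<close>, \<open>y\<close> of the projection on the facet hyperplane
  have a midpoint \<open>c\<close> on that hyperplane and inside the ball. As \<open>z'\<close> is
  strictly on the inner side, the chord from \<open>z'\<close> through \<open>c\<close> ends at a
  point \<open>p\<close> beyond the hyperplane. Convexity of \<open>M\<close> puts \<open>p\<close>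
  in the projection from \<open>z'\<close>, yet no ray from \<open>z\<close> through
  \<open>Q\<close> gets there.\<close>

lemma apex_unique:
  fixes M Q :: "'a::euclidean_space set"
  assumes dim: "DIM('a) \<ge> 3" and Q: "convex_polytope Q" "Q \<subseteq> ball 0 r"
    and M: "convex M" "M \<subseteq> ball 0 r" and z: "norm z = r" "norm z' = r"
    and eq: "spherical_projection r M z' = spherical_projection r Q z"
  shows "z' = z"
proof (rule ccontr)
  assume "z' \<noteq> z"
  then obtain a q1 q2 where a: "\<And>q. q \<in> Q \<Longrightarrow> a \<bullet> q \<le> a \<bullet> z" "a \<bullet> z' < a \<bullet> z"
    and q: "q1 \<in> Q" "q2 \<in> Q" "a \<bullet> q1 = a \<bullet> z" "a \<bullet> q2 = a \<bullet> z"
    and col: "\<not> collinear {z, q1, q2}"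
    using cone_facet_facing[OF dim Q z] by metis
  obtain s where s: "s > 1" "z + s *\<^sub>R (q1 - z) \<in> spherical_projection r Q z"
    using ray_hits_spherical_projection[OF Q(2) z(1) q(1)] .
  obtain t where t: "t > 1" "z + t *\<^sub>R (q2 - z) \<in> spherical_projection r Q z"
    using ray_hits_spherical_projection[OF Q(2) z(1) q(2)] .
  define x where "x = z + s *\<^sub>R (q1 - z)"
  define y where "y = z + t *\<^sub>R (q2 - z)"
  have sph: "norm x = r" "norm y = r"
    using s t by (auto simp: x_def y_def spherical_projection_def)
  have ax: "a \<bullet> x = a \<bullet> z" "a \<bullet> y = a \<bullet> z"
    using q by (auto simp: x_def y_def inner_add_right inner_diff_right)
  have "x \<noteq> y"
  proof
    assume "x = y"
    then have "s *\<^sub>R (q1 - z) = t *\<^sub>R (q2 - z)" by (simp add: x_def y_def)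
    then have "(1/s) *\<^sub>R (s *\<^sub>R (q1 - z)) = (1/s) *\<^sub>R (t *\<^sub>R (q2 - z))" by simp
    then have "q1 - z = (t / s) *\<^sub>R (q2 - z)" using s by simp
    then have "collinear {0, q2 - z, q1 - z}" by (auto simp: collinear_lemma)
    then have "collinear {z, q2, q1}" using collinear_3[of q2 z q1]  by (simp add: insert_commute)
    then show False using col by (simp add: insert_commute)
  qed
  obtain m1 \<sigma> where m1: "m1 \<in> M" "0 < \<sigma>" "\<sigma> \<le> 1" "m1 = z' + \<sigma> *\<^sub>R (x - z')"
    using spherical_projection_ray[OF M(2) z(2), of x] s(2) eq by (metis x_def)
  obtain m2 \<tau> where m2: "m2 \<in> M" "0 < \<tau>" "\<tau> \<le> 1" "m2 = z' + \<tau> *\<^sub>R (y - z')"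
    using spherical_projection_ray[OF M(2) z(2), of y] t(2) eq by (metis y_def)
  define c where "c = (1/2) *\<^sub>R (x + y)"
  have "norm c < r"
  proof -
    have "midpoint x y \<in> open_segment x y" using \<open>x \<noteq> y\<close> by simp
    then have "dist 0 (midpoint x y) < max (dist 0 x) (dist 0 y)"
      using dist_decreases_open_segment[of "midpoint x y" x y 0] by auto
    then show ?thesis using sph by (simp add: midpoint_def c_def)
  qed
  obtain k where k: "k > 0" "c + k *\<^sub>R (c - z') \<in> sphere 0 r"
    using chord_beyond[OF \<open>norm c < r\<close> z(2)] .
  define p where "p = c + k *\<^sub>R (c - z')"
  text \<open>\<open>\<kappa>\<close> is the harmonic mean: \<open>m\<close> is where the ray from \<open>z'\<close> through \<open>c\<close> meets the segment \<open>m1 m2\<close>.\<close>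
  define \<kappa> where "\<kappa> = 2 * \<sigma> * \<tau> / (\<sigma> + \<tau>)"
  define m where "m = z' + \<kappa> *\<^sub>R (c - z')"
  have \<kappa>: "0 < \<kappa>" "\<kappa> \<le> 1"
  proof -
    have "\<sigma> * \<tau> \<le> \<sigma>" "\<sigma> * \<tau> \<le> \<tau>" using m1 m2 by (auto simp: mult_left_le mult_left_le_one_le)
    then have "2 * \<sigma> * \<tau> \<le> \<sigma> + \<tau>" by linarith
    then show "0 < \<kappa>" "\<kappa> \<le> 1" using m1 m2 by (auto simp: \<kappa>_def divide_simps)
  qed
  have "m = (\<tau> / (\<sigma> + \<tau>)) *\<^sub>R m1 + (\<sigma> / (\<sigma> + \<tau>)) *\<^sub>R m2"
  proof -
    have st: "\<sigma> + \<tau> \<noteq> 0" using m1 m2 by auto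
    have "(\<sigma> + \<tau>) *\<^sub>R m = (\<sigma> + \<tau>) *\<^sub>R z' + (2 * \<sigma> * \<tau>) *\<^sub>R (c - z')"
      using st by (simp add: m_def \<kappa>_def scaleR_add_right)
    also have "\<dots> = \<tau> *\<^sub>R m1 + \<sigma> *\<^sub>R m2"
      by (simp add: c_def m1(4) m2(4) algebra_simps) (simp flip: scaleR_add_left)
    finally have "(1 / (\<sigma> + \<tau>)) *\<^sub>R ((\<sigma> + \<tau>) *\<^sub>R m) = (1 / (\<sigma> + \<tau>)) *\<^sub>R (\<tau> *\<^sub>R m1 + \<sigma> *\<^sub>R m2)" by simp
    then show ?thesis using st by (simp add: scaleR_add_right)
  qed
  moreover have "\<tau> / (\<sigma> + \<tau>) + \<sigma> / (\<sigma> + \<tau>) = 1" using m1 m2 by (simp add: divide_simps)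
  ultimately have "m \<in> M" using M(1) m1 m2 by (simp add: convex_def)
  \<comment> \<open>Since \<open>p - z'\<close> is \<open>1 + k\<close> times \<open>c - z'\<close>,
    the point \<open>m\<close> with parameter \<open>\<kappa>\<close> towards \<open>c\<close> has
    parameter \<open>l\<close> towards \<open>p\<close>, and \<open>l \<le> 1\<close> places it on
    the segment.\<close>
  define l where "l = \<kappa> / (1 + k)"
  have "l * (1 + k) = \<kappa>" using k(1) by (simp add: l_def)
  moreover have "p = z' + (1 + k) *\<^sub>R (c - z')" by (simp add: p_def algebra_simps)
  ultimately have "m = z' + l *\<^sub>R (p - z')" by (simp add: m_def)
  then have "m = (1 - (1 - l)) *\<^sub>R p + (1 - l) *\<^sub>R z'" by (simp add: algebra_simps)
  moreover have "0 \<le> 1 - l" "1 - l \<le> 1" using \<kappa> k(1) by (auto simp: l_def divide_simps)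
  ultimately have "m \<in> closed_segment p z'" unfolding closed_segment_def by blast
  then have "p \<in> spherical_projection r M z'"
    using \<open>m \<in> M\<close> k(2) by (auto simp: spherical_projection_def p_def)
  then obtain q \<rho> where \<rho>: "q \<in> Q" "0 < \<rho>" "q = z + \<rho> *\<^sub>R (p - z)"
    using spherical_projection_ray[OF Q(2) z(1)] eq by metis
  \<comment> \<open>A ray from \<open>z\<close> that meets \<open>Q\<close> obeys the supporting
    inequality, whereas \<open>p\<close> exceeds it by \<open>k\<close> times the positive gap at
    \<open>z'\<close>.\<close>
  have "\<rho> * (a \<bullet> p - a \<bullet> z) \<le> 0"
    using a(1)[OF \<rho>(1)] by (simp add: \<rho>(3) inner_add_right inner_diff_right)
  then have "a \<bullet> p \<le> a \<bullet> z" using \<rho>(2) by (simp add: mult_le_0_iff)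
  moreover have "a \<bullet> p = a \<bullet> z + k * (a \<bullet> z - a \<bullet> z')"
    using ax by (simp add: p_def c_def inner_add_right inner_diff_right)
  ultimately show False using a(2) k(1) by (simp add: mult_le_0_iff)
qed

section \<open>The angle equation as an algebraic condition on the sphere\<close>

text \<open>The squared and cross-multiplied form of the equality of the angles \<open>0zv\<close> and \<open>0zw\<close>.\<close>

definition equal_angle_poly :: "real \<Rightarrow> 'a::euclidean_space \<Rightarrow> 'a \<Rightarrow> 'a \<Rightarrow> real" where
  "equal_angle_poly r v w z =
     (r\<^sup>2 - z \<bullet> v)\<^sup>2 * (r\<^sup>2 + w \<bullet> w - 2 * (z \<bullet> w)) - (r\<^sup>2 - z \<bullet> w)\<^sup>2 * (r\<^sup>2 + v \<bullet> v - 2 * (z \<bullet> v))"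

text \<open>Any \<open>z \<noteq> - z0\<close> is reached from \<open>z0\<close> by a rational
  parametrization within the sphere. Along it the angle expression becomes, after clearing
  denominators, a polynomial in \<open>\<tau>\<close> that vanishes on an open set around 0 and
  therefore also at \<open>\<tau> = 1\<close>, which corresponds to \<open>z\<close>.\<close>

lemma equal_angle_poly_extend:
  fixes v w :: "'a::euclidean_space"
  assumes U: "open U" "z0 \<in> U" and z0: "norm z0 = r" and "r > 0"
    and zero: "\<And>z. z \<in> U \<Longrightarrow> norm z = r \<Longrightarrow> equal_angle_poly r v w z = 0"
    and z: "norm z = r" "z \<noteq> - z0"
  shows "equal_angle_poly r v w z = 0"
proof -
  define D where "D \<tau> = 2 *\<^sub>R z0 + \<tau> *\<^sub>R (z - z0)" for \<tau> :: real
  text \<open>\<open>Z \<tau>\<close> is the second point of the sphere on the line through \<open>- z0\<close> in direction \<open>D \<tau>\<close>: a rational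
    parametrization of the circle through \<open>- z0\<close>, \<open>z0\<close> and \<open>z\<close>.\<close>
  define Z where "Z \<tau> = - z0 + (2 * (z0 \<bullet> D \<tau>) / (D \<tau> \<bullet> D \<tau>)) *\<^sub>R D \<tau>" for \<tau>
  have zz: "z0 \<bullet> z0 = r\<^sup>2" "z \<bullet> z = r\<^sup>2" using z0 z by (simp_all add: dot_square_norm)
  have normZ: "norm (Z \<tau>) = r" if "D \<tau> \<noteq> 0" for \<tau>
  proof -
    define k where "k = 2 * (z0 \<bullet> D \<tau>) / (D \<tau> \<bullet> D \<tau>)"
    have k: "k * (D \<tau> \<bullet> D \<tau>) = 2 * (z0 \<bullet> D \<tau>)" using that by (simp add: k_def)
    have "Z \<tau> \<bullet> Z \<tau> = r\<^sup>2 - 2 * k * (z0 \<bullet> D \<tau>) + k * (k * (D \<tau> \<bullet> D \<tau>))"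
      by (simp add: Z_def flip: k_def)
        (simp add: zz inner_diff inner_commute algebra_simps)
    also have "\<dots> = r\<^sup>2" unfolding k by simp
    finally show ?thesis using \<open>r > 0\<close> by (simp add: dot_square_norm)
  qed
  \<comment> \<open>The values of \<open>pN\<close>, \<open>pL\<close>, \<open>pD x\<close> at
    \<open>\<tau>\<close> are the inner products of \<open>D \<tau>\<close> with itself,
    \<open>z0\<close> and \<open>x\<close>, and \<open>pS x\<close> is \<open>pN\<close> times
    \<open>Z \<tau> \<bullet> x\<close>. Both terms of the angle expression are products of three
    affine functions of the point, so \<open>G\<close> is that expression times the cube of
    \<open>pN\<close>.\<close>
  define pN where "pN = [: 4 * r\<^sup>2, 4 * (z0 \<bullet> (z - z0)), (z - z0) \<bullet> (z - z0) :]"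
  define pL where "pL = [: 2 * r\<^sup>2, z0 \<bullet> (z - z0) :]"
  define pD where "pD x = [: 2 * (z0 \<bullet> x), (z - z0) \<bullet> x :]" for x
  define pS where "pS x = [: 2 :] * pL * pD x - [: z0 \<bullet> x :] * pN" for x
  define G where "G = ([: r\<^sup>2 :] * pN - pS v)\<^sup>2 * ([: r\<^sup>2 + w \<bullet> w :] * pN - [: 2 :] * pS w)
     - ([: r\<^sup>2 :] * pN - pS w)\<^sup>2 * ([: r\<^sup>2 + v \<bullet> v :] * pN - [: 2 :] * pS v)"
  have pN: "poly pN \<tau> = D \<tau> \<bullet> D \<tau>" for \<tau>
    by (simp add: pN_def D_def inner_add inner_commute[of "z - z0" z0] zz) (simp add: algebra_simps)
  have pS: "poly (pS x) \<tau> = poly pN \<tau> * (Z \<tau> \<bullet> x)" if "D \<tau> \<noteq> 0" for x \<tau>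
  proof -
    have "poly pN \<tau> * (Z \<tau> \<bullet> x) = 2 * (z0 \<bullet> D \<tau>) * (D \<tau> \<bullet> x) - (z0 \<bullet> x) * poly pN \<tau>"
      using that unfolding pN by (simp add: Z_def inner_add_left inner_diff_left field_simps)
    moreover have "poly pL \<tau> = z0 \<bullet> D \<tau>"
      by (simp add: pL_def D_def inner_add_right zz)
    moreover have "poly (pD x) \<tau> = D \<tau> \<bullet> x"
      by (simp add: pD_def D_def inner_add_left)
    ultimately show ?thesis by (simp add: pS_def)
  qed
  have G: "poly G \<tau> = (poly pN \<tau>) ^ 3 * equal_angle_poly r v w (Z \<tau>)" if "D \<tau> \<noteq> 0" for \<tau>
  proof -
    have scale: "(a * N - N * s)\<^sup>2 * (A * N - 2 * (N * t)) - (a * N - N * t)\<^sup>2 * (B * N - 2 * (N * s))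
       = N ^ 3 * ((a - s)\<^sup>2 * (A - 2 * t) - (a - t)\<^sup>2 * (B - 2 * s))" for a A B N s t :: real
      by algebra
    have "poly G \<tau> = (r\<^sup>2 * poly pN \<tau> - poly (pS v) \<tau>)\<^sup>2 * ((r\<^sup>2 + w \<bullet> w) * poly pN \<tau> - 2 * poly (pS w) \<tau>)
       - (r\<^sup>2 * poly pN \<tau> - poly (pS w) \<tau>)\<^sup>2 * ((r\<^sup>2 + v \<bullet> v) * poly pN \<tau> - 2 * poly (pS v) \<tau>)"
      by (simp add: G_def)
    then show ?thesis unfolding pS[OF that] scale by (simp only: equal_angle_poly_def)
  qed
  have "z0 \<noteq> 0" using z0 \<open>r > 0\<close> by auto
  have D0: "D 0 \<noteq> 0" using \<open>z0 \<noteq> 0\<close> by (simp add: D_def)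
  have Z0: "Z 0 = z0" using \<open>z0 \<noteq> 0\<close> by (simp add: Z_def D_def) (simp add: scaleR_2)
  \<comment> \<open>\<open>D 1 = z0 + z\<close>, so excluding \<open>- z0\<close> is what keeps the
    denominator nonzero at the endpoint.\<close>
  have D1: "D 1 \<noteq> 0"
    using z(2) by (simp add: D_def scaleR_2 eq_neg_iff_add_eq_0 add.commute)
  have Z1: "Z 1 = z"
  proof -
    have "D 1 = z0 + z" by (simp add: D_def scaleR_2)
    moreover from this have "2 * (z0 \<bullet> D 1) = D 1 \<bullet> D 1"
      by (simp add: inner_add_left inner_add_right zz inner_commute[of z z0])
    ultimately show ?thesis using D1 by (simp add: Z_def)
  qed
  have contD: "continuous_on UNIV D" unfolding D_def by (intro continuous_intros)
  have oD: "open (D -` (- {0}))"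
    using open_vimage[OF _ contD, of "- {0}"] by auto
  have contZ: "continuous_on (D -` (- {0})) Z"
    unfolding Z_def using continuous_on_subset[OF contD] by (intro continuous_intros) auto
  have "open (D -` (- {0}) \<inter> Z -` U)"
    using continuous_on_open_vimage[OF oD] contZ U(1) by (metis inf_commute)
  moreover have "D -` (- {0}) \<inter> Z -` U \<noteq> {}" using D0 Z0 U(2) by auto
  ultimately have inf: "infinite (D -` (- {0}) \<inter> Z -` U)"
    by (metis finite_imp_not_open)
  have "D -` (- {0}) \<inter> Z -` U \<subseteq> {\<tau>. poly G \<tau> = 0}"
    using G zero normZ by auto
  then have "G = 0" using inf poly_roots_finite[of G] finite_subset by blast
  then have "poly pN 1 ^ 3 * equal_angle_poly r v w z = 0" using G[OF D1] Z1 by simp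
  then show ?thesis using D1 by (simp add: pN)
qed

text \<open>The extension from \<open>z0\<close> misses only the antipode \<open>- z0\<close>. The
  complement of \<open>- z0\<close> is an open set in which the expression vanishes on the sphere,
  so a second extension based at \<open>r *\<^sub>R e\<close> covers the antipode.\<close>

lemma equal_angle_poly_everywhere:
  fixes v w :: "'a::euclidean_space"
  assumes dim: "DIM('a) \<ge> 3" and U: "open U" "z0 \<in> U" and z0: "norm z0 = r" and "r > 0"
    and zero: "\<And>z. z \<in> U \<Longrightarrow> norm z = r \<Longrightarrow> equal_angle_poly r v w z = 0"
    and z: "norm z = r"
  shows "equal_angle_poly r v w z = 0"
proof (cases "z = - z0")
  case False
  then show ?thesis using equal_angle_poly_extend[OF U z0 \<open>r > 0\<close> zero z] by simp
next
  case True
  obtain e where e: "norm e = 1" "e \<bullet> z0 = 0" using unit_orthogonal_to_pair[OF dim] by metis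
  have ne: "r *\<^sub>R e \<noteq> z0" "r *\<^sub>R e \<noteq> - z0" proof -
    have "e \<bullet> (r *\<^sub>R e) = r" using e by (simp add: norm_eq_1)
    moreover have "e \<bullet> (- z0) = 0" using e(2) by simp
    ultimately show "r *\<^sub>R e \<noteq> z0" "r *\<^sub>R e \<noteq> - z0" using e(2) \<open>r > 0\<close> by (metis less_irrefl)+
  qed
  have op: "open (- {- z0})" by (intro open_Compl closed_singleton)
  have "equal_angle_poly r v w y = 0" if "y \<in> - {- z0}" "norm y = r" for y
    using equal_angle_poly_extend[OF U z0 \<open>r > 0\<close> zero] that by simp
  moreover have "r *\<^sub>R e \<in> - {- z0}" "norm (r *\<^sub>R e) = r" "z \<noteq> - (r *\<^sub>R e)"
    using ne e(1) \<open>r > 0\<close> True by simp_all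
  ultimately show ?thesis
    using equal_angle_poly_extend[OF op _ _ \<open>r > 0\<close> _ z, of "r *\<^sub>R e"] by blast
qed

text \<open>Splitting the identity into even and odd parts in \<open>z\<close> gives
  \<open>A = B\<close> and \<open>(z \<bullet> v)\<^sup>2 = (z \<bullet> w)\<^sup>2\<close>. Where
  the two inner products differ they are opposite and nonzero, and the odd part then pins their
  square to one constant, which two suitable points of the sphere contradict.\<close>

lemma equal_angle_poly_identity:
  fixes v w :: "'a::euclidean_space"
  assumes dim: "DIM('a) \<ge> 3" and "r > 0"
    and zero: "\<And>z. norm z = r \<Longrightarrow> equal_angle_poly r v w z = 0"
  shows "v = w"
proof (rule ccontr)
  assume "v \<noteq> w"
  define a where "a = r\<^sup>2"
  define A where "A = a + w \<bullet> w"
  define B where "B = a + v \<bullet> v"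
  have pos: "a > 0" "A > 0" using \<open>r > 0\<close> by (auto simp: a_def A_def add_pos_nonneg)
  have plus: "(a - z \<bullet> v)\<^sup>2 * (A - 2 * (z \<bullet> w)) = (a - z \<bullet> w)\<^sup>2 * (B - 2 * (z \<bullet> v))" if "norm z = r" for z
    using zero[OF that] by (simp add: equal_angle_poly_def a_def A_def B_def)
  have minus: "(a + z \<bullet> v)\<^sup>2 * (A + 2 * (z \<bullet> w)) = (a + z \<bullet> w)\<^sup>2 * (B + 2 * (z \<bullet> v))" if "norm z = r" for z
    using plus[of "- z"] that by simp
  have even: "(a\<^sup>2 + (z \<bullet> v)\<^sup>2) * A = (a\<^sup>2 + (z \<bullet> w)\<^sup>2) * B" if "norm z = r" for z
    using plus[OF that] minus[OF that] by algebra
  have odd: "a * (z \<bullet> v) * A + (z \<bullet> w) * (a\<^sup>2 + (z \<bullet> v)\<^sup>2) = a * (z \<bullet> w) * B + (z \<bullet> v) * (a\<^sup>2 + (z \<bullet> w)\<^sup>2)"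
    if "norm z = r" for z
    using plus[OF that] minus[OF that] by algebra
  obtain e where e: "norm e = 1" "e \<bullet> v = 0" "e \<bullet> w = 0" using unit_orthogonal_to_pair[OF dim] .
  \<comment> \<open>At \<open>r *\<^sub>R e\<close> both inner products vanish, which leaves
    \<open>a\<^sup>2 * A = a\<^sup>2 * B\<close>.\<close>
  have "A = B" using even[of "r *\<^sub>R e"] e pos \<open>r > 0\<close> by simp
  have sq: "(z \<bullet> v)\<^sup>2 = (z \<bullet> w)\<^sup>2" if "norm z = r" for z
    using even[OF that] \<open>A = B\<close> pos by auto
  define \<delta> where "\<delta> = norm (v - w)"
  define n where "n = (v - w) /\<^sub>R \<delta>"
  have "\<delta> > 0" using \<open>v \<noteq> w\<close> by (simp add: \<delta>_def)
  have n: "norm n = 1" "n \<bullet> v - n \<bullet> w = \<delta>" "n \<bullet> n = 1" "n \<bullet> e = 0"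
  proof -
    show n1: "norm n = 1" using \<open>\<delta> > 0\<close> by (simp add: n_def \<delta>_def)
    show "n \<bullet> n = 1" using n1 by (simp add: norm_eq_1)
    have "n \<bullet> (v - w) = \<delta>"
      using \<open>\<delta> > 0\<close> by (simp add: n_def dot_square_norm power2_eq_square flip: \<delta>_def)
    then show "n \<bullet> v - n \<bullet> w = \<delta>" by (simp add: inner_diff_right)
    show "n \<bullet> e = 0" using e by (simp add: n_def inner_commute[of _ e] inner_diff_right)
  qed
  have key: "(z \<bullet> v)\<^sup>2 = a * A - a\<^sup>2" "z \<bullet> v - z \<bullet> w = 2 * (z \<bullet> v)" if "norm z = r" "z \<bullet> v \<noteq> z \<bullet> w" for z
  proof -
    have t: "z \<bullet> w = - (z \<bullet> v)" using sq[OF that(1)] that(2) by (metis minus_minus power2_eq_iff)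
    have "z \<bullet> v \<noteq> 0" using t that(2) by auto
    have "(z \<bullet> v) * ((z \<bullet> v)\<^sup>2 - (a * A - a\<^sup>2)) = 0"
      using odd[OF that(1)] \<open>A = B\<close> unfolding t by (simp add: algebra_simps power2_eq_square)
    then show "(z \<bullet> v)\<^sup>2 = a * A - a\<^sup>2" using \<open>z \<bullet> v \<noteq> 0\<close> by simp
    show "z \<bullet> v - z \<bullet> w = 2 * (z \<bullet> v)" using t by simp
  qed
  \<comment> \<open>\<open>n\<close> and \<open>e\<close> are orthonormal and 3/5, 4/5 is a
    Pythagorean pair, so \<open>z2\<close> is again on the sphere while its component along
    \<open>n\<close> shrinks by the factor 3/5. At both points \<open>z \<bullet> v\<close> is half
    the difference of the inner products, so its square would take two values.\<close>
  define z1 where "z1 = r *\<^sub>R n"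
  define z2 where "z2 = r *\<^sub>R ((3/5) *\<^sub>R n + (4/5) *\<^sub>R e)"
  have z1: "norm z1 = r" "z1 \<bullet> v - z1 \<bullet> w = r * \<delta>"
    using n \<open>r > 0\<close> by (simp_all add: z1_def flip: right_diff_distrib)
  have z2: "norm z2 = r" "z2 \<bullet> v - z2 \<bullet> w = (3/5) * (r * \<delta>)"
  proof -
    have "norm ((3/5) *\<^sub>R n + (4/5) *\<^sub>R e) = 1"
      using n e by (simp add: norm_eq_1 inner_add inner_commute[of e n])
    then show "norm z2 = r" using \<open>r > 0\<close> by (simp add: z2_def)
    show "z2 \<bullet> v - z2 \<bullet> w = (3/5) * (r * \<delta>)"
      using n(2) e by (simp add: z2_def inner_add_left algebra_simps flip: right_diff_distrib)
  qed
  have "r * \<delta> > 0" using \<open>r > 0\<close> \<open>\<delta> > 0\<close> by simp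
  then have ne: "z1 \<bullet> v \<noteq> z1 \<bullet> w" "z2 \<bullet> v \<noteq> z2 \<bullet> w" using z1 z2 by auto
  have "z2 \<bullet> v = (3/5) * (z1 \<bullet> v)" "z1 \<bullet> v > 0"
    using key(2)[OF z1(1) ne(1)] key(2)[OF z2(1) ne(2)] z1 z2 \<open>r * \<delta> > 0\<close> by linarith+
  moreover have "(z2 \<bullet> v)\<^sup>2 = (z1 \<bullet> v)\<^sup>2" using key(1)[OF z1(1) ne(1)] key(1)[OF z2(1) ne(2)] by simp
  ultimately show False by (simp add: power2_eq_iff_nonneg)
qed

text \<open>Finiteness enters in contrapositive form: instead of finding one \<open>w\<close> that
  serves on an open set, the open set is shrunk for each \<open>w\<close> in turn. It keeps meeting
  the sphere, since vanishing on the whole remaining piece would spread over the sphere and force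
  \<open>v = w\<close>.\<close>

lemma exists_unequal_angle_points:
  fixes v :: "'a::euclidean_space"
  assumes dim: "DIM('a) \<ge> 3" and "r > 0" and W: "finite W" "v \<notin> W"
    and U: "open U" "U \<inter> sphere 0 r \<noteq> {}"
  shows "\<exists>U'. open U' \<and> U' \<subseteq> U \<and> U' \<inter> sphere 0 r \<noteq> {} \<and>
           (\<forall>z \<in> U'. \<forall>w \<in> W. equal_angle_poly r v w z \<noteq> 0)"
  using W
proof (induction W)
  case empty
  then show ?case using U by auto
next
  case (insert w W)
  then obtain U' where U': "open U'" "U' \<subseteq> U" "U' \<inter> sphere 0 r \<noteq> {}"
    "\<forall>z \<in> U'. \<forall>w \<in> W. equal_angle_poly r v w z \<noteq> 0" by auto
  obtain z0 where z0: "z0 \<in> U'" "norm z0 = r" using U'(3) by (metis IntE all_not_in_conv mem_sphere_0)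
  obtain z1 where z1: "z1 \<in> U'" "norm z1 = r" "equal_angle_poly r v w z1 \<noteq> 0"
    using equal_angle_poly_everywhere[OF dim U'(1) z0 \<open>r > 0\<close>]
      equal_angle_poly_identity[OF dim \<open>r > 0\<close>] insert.prems by blast
  have "continuous_on UNIV (equal_angle_poly r v w)"
    unfolding equal_angle_poly_def by (intro continuous_intros)
  then have "open (equal_angle_poly r v w -` (- {0}))"
    by (intro open_vimage) auto
  then have "open (U' \<inter> equal_angle_poly r v w -` (- {0}))" using U'(1) by blast
  then show ?case using z1 U'
    by (intro exI[of _ "U' \<inter> equal_angle_poly r v w -` (- {0})"]) auto
qed

section \<open>Exposed extreme points and the rays through them\<close>

lemma extreme_point_exposing:
  fixes P :: "'a::euclidean_space set"
  assumes "polytope P" "v extreme_point_of P"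
  obtains c where "\<And>p. p \<in> P \<Longrightarrow> p \<noteq> v \<Longrightarrow> c \<bullet> p < c \<bullet> v"
proof -
  have "{v} face_of P" using assms(2) by (simp add: face_of_singleton)
  then have "{v} exposed_face_of P"
    using exposed_face_of_polyhedron polytope_imp_polyhedron[OF assms(1)] by blast
  then obtain a b where ab: "P \<subseteq> {x. a \<bullet> x \<le> b}" "{v} = P \<inter> {x. a \<bullet> x = b}"
    by (auto simp: exposed_face_of_def)
  then have av: "a \<bullet> v = b" by auto
  show ?thesis
  proof
    show "a \<bullet> p < a \<bullet> v" if "p \<in> P" "p \<noteq> v" for p
      using that ab av by (metis (mono_tags, lifting) IntI antisym_conv2 mem_Collect_eq singletonD subsetD)
  qed
qed

text \<open>The face of \<open>P\<close> on which \<open>c\<close> is maximal is the hull of the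
  extreme points it contains, hence of \<open>v\<close> alone. Exposure of \<open>v\<close> thus
  reduces to finitely many strict inequalities, a condition stable under perturbation.\<close>

lemma exposing_from_extreme_points:
  fixes P :: "'a::euclidean_space set"
  assumes P: "polytope P" and v: "v extreme_point_of P"
    and c: "\<And>p. p extreme_point_of P \<Longrightarrow> p \<noteq> v \<Longrightarrow> c \<bullet> p < c \<bullet> v"
  shows "p \<in> P \<Longrightarrow> c \<bullet> p \<le> c \<bullet> v" and "p \<in> P \<Longrightarrow> c \<bullet> p = c \<bullet> v \<Longrightarrow> p = v"
proof -
  define W where "W = {x. x extreme_point_of P}"
  have PW: "P = convex hull W"
    unfolding W_def using Krein_Milman_Minkowski polytope_imp_compact[OF P] polytope_imp_convex[OF P] by blast
  have "finite W" unfolding W_def using finite_polyhedron_extreme_points polytope_imp_polyhedron[OF P] by blast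
  have "W \<subseteq> {x. c \<bullet> x \<le> c \<bullet> v}" using c unfolding W_def by (metis (mono_tags, lifting) less_eq_real_def mem_Collect_eq subsetI)
  then have "P \<subseteq> {x. c \<bullet> x \<le> c \<bullet> v}" unfolding PW by (intro hull_minimal) (simp_all add: convex_halfspace_le)
  then show le: "\<And>p. p \<in> P \<Longrightarrow> c \<bullet> p \<le> c \<bullet> v" by auto
  define T where "T = P \<inter> {x. c \<bullet> x = c \<bullet> v}"
  have "T face_of P" unfolding T_def
    using le face_of_Int_supporting_hyperplane_le polytope_imp_convex[OF P] by blast
  then obtain S where S: "S \<subseteq> W" "T = convex hull S"
    using face_of_convex_hull_subset[of W T] finite_imp_compact[OF \<open>finite W\<close>] PW by metis
  have "S \<subseteq> T" using S by (simp add: hull_subset)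
  then have "S \<subseteq> {v}" using S(1) c unfolding T_def W_def by fastforce
  then have "T \<subseteq> {v}" unfolding S(2) by (metis convex_singleton hull_minimal)
  then show "p \<in> P \<Longrightarrow> c \<bullet> p = c \<bullet> v \<Longrightarrow> p = v" by (auto simp: T_def)
qed

text \<open>The exposing hyperplane of \<open>v\<close> meets the sphere at some \<open>z0\<close>.
  For \<open>z\<close> near \<open>z0\<close> it can be turned slightly so as to contain
  \<open>z\<close>, and the strict inequalities at the other extreme points survive. Geometrically,
  \<open>v\<close> then spans an exposed ray of the cone over \<open>P\<close> with apex
  \<open>z\<close>.\<close>

lemma exposing_directions_open:
  fixes P :: "'a::euclidean_space set"
  assumes dim: "DIM('a) \<ge> 3" and P: "convex_polytope P" "P \<subseteq> ball 0 r" and v: "v extreme_point_of P"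
  obtains U where "open U" "U \<inter> sphere 0 r \<noteq> {}"
    "\<And>z. z \<in> U \<Longrightarrow> \<exists>c. c \<bullet> z = c \<bullet> v \<and> (\<forall>p\<in>P. c \<bullet> p \<le> c \<bullet> v \<and> (c \<bullet> p = c \<bullet> v \<longrightarrow> p = v))"
proof -
  have pol: "polytope P" using P by (simp add: convex_polytope_def)
  obtain c0 where c0: "\<And>p. p \<in> P \<Longrightarrow> p \<noteq> v \<Longrightarrow> c0 \<bullet> p < c0 \<bullet> v"
    using extreme_point_exposing[OF pol v] by metis
  define W where "W = {x. x extreme_point_of P}"
  have "finite W" unfolding W_def using finite_polyhedron_extreme_points polytope_imp_polyhedron[OF pol] by blast
  have WP: "W \<subseteq> P" by (auto simp: W_def extreme_point_of_def)
  have vb: "norm v < r" using v P(2) by (auto simp: extreme_point_of_def)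
  \<comment> \<open>\<open>e\<close> is a direction within the exposing hyperplane, so
    \<open>z0\<close> stays on it and the tilt below is zero at \<open>z0\<close>.\<close>
  obtain e where e: "norm e = 1" "e \<bullet> c0 = 0" using unit_orthogonal_to_pair[OF dim] by metis
  have "e \<noteq> 0" using e by auto
  then obtain t where t: "t > 0" "v + t *\<^sub>R e \<in> frontier (cball 0 r)"
    using ray_to_frontier[of "cball 0 r" v e] vb by (auto simp: interior_cball)
  define z0 where "z0 = v + t *\<^sub>R e"
  have z0: "norm z0 = r" "z0 \<noteq> v" "c0 \<bullet> (z0 - v) = 0"
    using t e \<open>e \<noteq> 0\<close> by (auto simp: z0_def frontier_cball inner_commute)
  text \<open>The normal \<open>c0\<close> is tilted to the nearest one whose hyperplane through \<open>v\<close> contains \<open>z\<close>.\<close>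
  define G where "G z = c0 - ((c0 \<bullet> (z - v)) / ((z - v) \<bullet> (z - v))) *\<^sub>R (z - v)" for z
  have Gz: "G z \<bullet> z = G z \<bullet> v" if "z \<noteq> v" for z
  proof -
    have "(c0 - ((c0 \<bullet> y) / (y \<bullet> y)) *\<^sub>R y) \<bullet> y = 0" if "y \<noteq> 0" for y
      using that by (simp add: inner_diff_left)
    then have "G z \<bullet> (z - v) = 0" using that by (simp add: G_def)
    then show ?thesis by (simp add: inner_diff_right)
  qed
  have G0: "G z0 = c0" using z0 by (simp add: G_def)
  have contG: "continuous_on (- {v}) G"
    unfolding G_def by (intro continuous_intros) auto
  define U where "U = - {v} \<inter> (\<Inter>p \<in> W - {v}. (- {v}) \<inter> (\<lambda>z. G z \<bullet> p - G z \<bullet> v) -` {..<0})"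
  have op: "open ((- {v}) \<inter> (\<lambda>z. G z \<bullet> p - G z \<bullet> v) -` {..<0})" for p
  proof -
    have "continuous_on (- {v}) (\<lambda>z. G z \<bullet> p - G z \<bullet> v)" using contG by (intro continuous_intros)
    then show ?thesis
      using continuous_on_open_vimage[of "- {v}"] by (metis inf_commute open_Compl closed_singleton open_lessThan)
  qed
  show ?thesis
  proof
    show "open U" unfolding U_def using op \<open>finite W\<close> by (intro open_Int open_INT) auto
    have "z0 \<in> U" using z0(2) c0 WP by (auto simp: U_def G0)
    then show "U \<inter> sphere 0 r \<noteq> {}" using z0(1) by auto
    fix z assume z: "z \<in> U"
    then have "z \<noteq> v" by (auto simp: U_def)
    have lt: "G z \<bullet> p < G z \<bullet> v" if "p extreme_point_of P" "p \<noteq> v" for p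
    proof -
      have "p \<in> W - {v}" using that by (simp add: W_def)
      then have "z \<in> (\<lambda>z. G z \<bullet> p - G z \<bullet> v) -` {..<0}" using z unfolding U_def by blast
      then show ?thesis by simp
    qed
    show "\<exists>c. c \<bullet> z = c \<bullet> v \<and> (\<forall>p\<in>P. c \<bullet> p \<le> c \<bullet> v \<and> (c \<bullet> p = c \<bullet> v \<longrightarrow> p = v))"
      using exposing_from_extreme_points[OF pol v lt] Gz[OF \<open>z \<noteq> v\<close>] by metis
  qed
qed

text \<open>Equal projections mean equal cones with apex \<open>z\<close>, so a hyperplane through
  \<open>z\<close> that touches \<open>M\<close> only at \<open>y\<close> supports \<open>Q\<close>
  along the ray through \<open>y\<close>. The face \<open>T\<close> of \<open>Q\<close> cut out
  there is nonempty and lies on this ray, and its extreme points are extreme in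
  \<open>Q\<close>.\<close>

lemma exposed_ray_transfer:
  fixes M Q :: "'a::euclidean_space set"
  assumes M: "M \<subseteq> ball 0 r" and Q: "compact Q" "convex Q" "Q \<subseteq> ball 0 r" and z: "norm z = r"
    and eq: "spherical_projection r M z = spherical_projection r Q z"
    and b: "b \<bullet> z = b \<bullet> y" "\<And>m. m \<in> M \<Longrightarrow> b \<bullet> m \<le> b \<bullet> y" "\<And>m. m \<in> M \<Longrightarrow> b \<bullet> m = b \<bullet> y \<Longrightarrow> m = y"
    and "y \<in> M"
  obtains w \<alpha> where "w extreme_point_of Q" "\<alpha> > 0" "y - z = \<alpha> *\<^sub>R (w - z)"
proof -
  have ray: "\<exists>m \<alpha>. m \<in> M \<and> \<alpha> > 0 \<and> b \<bullet> m - b \<bullet> z = \<alpha> * (b \<bullet> q - b \<bullet> z) \<and> m - z = \<alpha> *\<^sub>R (q - z)" if "q \<in> Q" for q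
  proof -
    obtain m \<alpha> where m: "m \<in> M" "\<alpha> > 0" "m - z = \<alpha> *\<^sub>R (q - z)"
      using same_projection_same_rays[OF M Q(3) z _ \<open>q \<in> Q\<close>] eq by blast
    from m(3) have "b \<bullet> (m - z) = b \<bullet> (\<alpha> *\<^sub>R (q - z))" by simp
    then have "b \<bullet> m - b \<bullet> z = \<alpha> * (b \<bullet> q - b \<bullet> z)" by (simp add: inner_diff_right)
    then show ?thesis using m by blast
  qed
  have le: "b \<bullet> q \<le> b \<bullet> z" if "q \<in> Q" for q
  proof -
    obtain m \<alpha> where "m \<in> M" "\<alpha> > 0" "b \<bullet> m - b \<bullet> z = \<alpha> * (b \<bullet> q - b \<bullet> z)"
      using ray[OF \<open>q \<in> Q\<close>] by blast
    with b(1,2) have "\<alpha> * (b \<bullet> q - b \<bullet> z) \<le> 0" by (metis diff_le_0_iff_le)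
    then show ?thesis using \<open>\<alpha> > 0\<close> by (simp add: mult_le_0_iff)
  qed
  define T where "T = Q \<inter> {x. b \<bullet> x = b \<bullet> z}"
  have T: "T face_of Q" unfolding T_def using le face_of_Int_supporting_hyperplane_le Q(2) by blast
  obtain q \<beta> where "q \<in> Q" "q - z = \<beta> *\<^sub>R (y - z)"
    using same_projection_same_rays[OF Q(3) M z _ \<open>y \<in> M\<close>] eq by blast
  then have "b \<bullet> (q - z) = 0" using b(1) by (simp add: inner_diff_right)
  then have "T \<noteq> {}" using \<open>q \<in> Q\<close> by (auto simp: T_def inner_diff_right)
  moreover have "compact T" "convex T"
    using T Q face_of_imp_compact face_of_imp_convex by blast+
  ultimately obtain w where w: "w extreme_point_of T"
    using extreme_point_exists_convex by blast
  then have "w \<in> T" by (simp add: extreme_point_of_def)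
  obtain m \<alpha> where m: "m \<in> M" "\<alpha> > 0" "b \<bullet> m - b \<bullet> z = \<alpha> * (b \<bullet> w - b \<bullet> z)" "m - z = \<alpha> *\<^sub>R (w - z)"
    using ray[of w] \<open>w \<in> T\<close> by (auto simp: T_def)
  then have "m = y" using b \<open>w \<in> T\<close> by (auto simp: T_def)
  then show ?thesis using that[of w \<alpha>] m w extreme_point_of_face[OF T] by blast
qed

text \<open>The angle at \<open>z\<close> depends only on norms and inner products with
  \<open>z\<close>, so \<open>v\<close> may be traded for \<open>y\<close>, which is collinear with
  \<open>z\<close> and \<open>w\<close>. The two quantities compared then scale by
  \<open>\<alpha>\<close> and \<open>\<alpha>\<^sup>2\<close>, and these factors cancel.\<close>

lemma equal_angle_poly_zero:
  fixes y v w z :: "'a::euclidean_space"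
  assumes z: "norm z = r" and \<alpha>: "y - z = \<alpha> *\<^sub>R (w - z)" and "norm y = norm v" "z \<bullet> y = z \<bullet> v"
  shows "equal_angle_poly r v w z = 0"
proof -
  have zz: "z \<bullet> z = r\<^sup>2" using z by (simp add: dot_square_norm)
  have yy: "y \<bullet> y = v \<bullet> v" using assms(3) by (simp add: dot_square_norm)
  have "z \<bullet> (y - z) = z \<bullet> (\<alpha> *\<^sub>R (w - z))" by (simp add: \<alpha>)
  then have 1: "r\<^sup>2 - z \<bullet> v = \<alpha> * (r\<^sup>2 - z \<bullet> w)"
    by (simp add: inner_diff_right zz assms(4) algebra_simps)
  have "(y - z) \<bullet> (y - z) = \<alpha>\<^sup>2 * ((w - z) \<bullet> (w - z))" by (simp add: \<alpha> power2_eq_square)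
  then have 2: "r\<^sup>2 + v \<bullet> v - 2 * (z \<bullet> v) = \<alpha>\<^sup>2 * (r\<^sup>2 + w \<bullet> w - 2 * (z \<bullet> w))"
    by (simp add: inner_diff zz yy assms(4) inner_commute[of y z] inner_commute[of w z] algebra_simps)
  have "(\<alpha> * a)\<^sup>2 * b - a\<^sup>2 * (\<alpha>\<^sup>2 * b) = 0" for a b
    by (simp add: power_mult_distrib)
  then show ?thesis by (simp only: equal_angle_poly_def 1 2)
qed

section \<open>Transport by orthogonal maps and equality of the extreme points\<close>

lemma spherical_projection_orthogonal_image:
  fixes \<phi> :: "'a::euclidean_space \<Rightarrow> 'a"
  assumes "orthogonal_transformation \<phi>"
  shows "spherical_projection r (\<phi> ` K) (\<phi> z) = \<phi> ` spherical_projection r K z"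
proof -
  have lin: "linear \<phi>" and inj: "inj \<phi>" and surj: "surj \<phi>"
    using assms orthogonal_transformation_linear orthogonal_transformation_inj orthogonal_transformation_surj[OF assms] by blast+
  have norm: "norm (\<phi> x) = norm x" for x using assms by (rule orthogonal_transformation_norm)
  have seg: "closed_segment (\<phi> x) (\<phi> z) \<inter> \<phi> ` K = \<phi> ` (closed_segment x z \<inter> K)" for x
    using closed_segment_linear_image[OF lin] inj by (simp add: image_Int)
  show ?thesis
  proof (intro equalityI subsetI)
    fix y assume y: "y \<in> spherical_projection r (\<phi> ` K) (\<phi> z)"
    obtain x where "y = \<phi> x" using surj by blast
    with y show "y \<in> \<phi> ` spherical_projection r K z"
      by (auto simp: spherical_projection_def norm seg)
  next
    fix y assume "y \<in> \<phi> ` spherical_projection r K z"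
    then show "y \<in> spherical_projection r (\<phi> ` K) (\<phi> z)"
      by (auto simp: spherical_projection_def norm seg)
  qed
qed

text \<open>A point \<open>z\<close> is chosen at which \<open>v\<close> spans an exposed ray and no
  vertex of \<open>Q\<close> satisfies the angle equation with \<open>v\<close>. There the
  congruence fixes \<open>z\<close> and carries \<open>v\<close> onto the ray of some vertex
  \<open>w\<close> of \<open>Q\<close>; since \<open>\<phi>\<close> preserves norms and inner
  products, the equation holds for \<open>w\<close> after all.\<close>

lemma extreme_points_subset:
  fixes P Q :: "'a::euclidean_space set"
  assumes dim: "DIM('a) \<ge> 3" and "r > 0" and P: "convex_polytope P" "P \<subseteq> ball 0 r"
    and Q: "convex_polytope Q" "Q \<subseteq> ball 0 r"
    and cong: "\<And>z. z \<in> sphere 0 r \<Longrightarrow>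
      congruent_sets (spherical_projection r P z) (spherical_projection r Q z)"
    and v: "v extreme_point_of P"
  shows "v extreme_point_of Q"
proof (rule ccontr)
  assume "\<not> v extreme_point_of Q"
  define W where "W = {x. x extreme_point_of Q}"
  have polQ: "polytope Q" and polP: "polytope P" using Q P by (auto simp: convex_polytope_def)
  have W: "finite W" "v \<notin> W"
    using finite_polyhedron_extreme_points polytope_imp_polyhedron[OF polQ] \<open>\<not> v extreme_point_of Q\<close>
    unfolding W_def by blast+
  obtain U where U: "open U" "U \<inter> sphere 0 r \<noteq> {}"
    and Uc: "\<And>z. z \<in> U \<Longrightarrow> \<exists>c. c \<bullet> z = c \<bullet> v \<and> (\<forall>p\<in>P. c \<bullet> p \<le> c \<bullet> v \<and> (c \<bullet> p = c \<bullet> v \<longrightarrow> p = v))"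
    using exposing_directions_open[OF dim P v] by metis
  obtain z where z: "z \<in> U" "norm z = r" and ne: "\<forall>w \<in> W. equal_angle_poly r v w z \<noteq> 0"
    using exists_unequal_angle_points[OF dim \<open>r > 0\<close> W U] by fastforce
  obtain c where c: "c \<bullet> z = c \<bullet> v" "\<forall>p\<in>P. c \<bullet> p \<le> c \<bullet> v \<and> (c \<bullet> p = c \<bullet> v \<longrightarrow> p = v)"
    using Uc[OF z(1)] by blast
  obtain \<phi> where \<phi>: "orthogonal_transformation \<phi>"
    and "\<phi> ` spherical_projection r P z = spherical_projection r Q z"
    using cong[of z] z(2) by (auto simp: congruent_sets_def)
  then have eq: "spherical_projection r (\<phi> ` P) (\<phi> z) = spherical_projection r Q z"
    by (simp add: spherical_projection_orthogonal_image)
  have norm: "norm (\<phi> x) = norm x" for x using \<phi> by (rule orthogonal_transformation_norm)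
  have inner: "\<phi> x \<bullet> \<phi> y = x \<bullet> y" for x y using \<phi> by (simp add: orthogonal_transformation_def)
  have M: "\<phi> ` P \<subseteq> ball 0 r" using P(2) by (auto simp: norm)
  have "convex (\<phi> ` P)"
    using convex_linear_image orthogonal_transformation_linear[OF \<phi>] polytope_imp_convex[OF polP] by blast
  \<comment> \<open>The image of \<open>P\<close> under \<open>\<phi>\<close>, seen from
    \<open>\<phi> z\<close>, has the same projection as \<open>Q\<close> seen from \<open>z\<close>,
    so the two apexes coincide.\<close>
  then have "\<phi> z = z"
    using apex_unique[OF dim Q _ M z(2) _ eq] z(2) norm by simp
  have "v \<in> P" using v by (simp add: extreme_point_of_def)
  \<comment> \<open>As \<open>\<phi>\<close> preserves inner products and fixes \<open>z\<close>,
    the functional \<open>\<phi> c\<close> exposes \<open>\<phi> v\<close> in the image of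
    \<open>P\<close> by a hyperplane through \<open>z\<close>.\<close>
  obtain w \<alpha> where w: "w extreme_point_of Q" "\<phi> v - z = \<alpha> *\<^sub>R (w - z)"
  proof (rule exposed_ray_transfer[OF M polytope_imp_compact[OF polQ] polytope_imp_convex[OF polQ] Q(2) z(2),
        of "\<phi> c" "\<phi> v"])
    show "spherical_projection r (\<phi> ` P) z = spherical_projection r Q z" using eq \<open>\<phi> z = z\<close> by simp
    show "\<phi> c \<bullet> z = \<phi> c \<bullet> \<phi> v" using inner[of c z] inner[of c v] c(1) \<open>\<phi> z = z\<close> by simp
    show "\<phi> c \<bullet> m \<le> \<phi> c \<bullet> \<phi> v" if "m \<in> \<phi> ` P" for m using that c(2) by (auto simp: inner)
    show "m = \<phi> v" if "m \<in> \<phi> ` P" "\<phi> c \<bullet> m = \<phi> c \<bullet> \<phi> v" for m using that c(2) by (auto simp: inner)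
    show "\<phi> v \<in> \<phi> ` P" using \<open>v \<in> P\<close> by simp
  qed (use that in auto)
  have "z \<bullet> \<phi> v = z \<bullet> v" using inner[of z v] \<open>\<phi> z = z\<close> by simp
  then have "equal_angle_poly r v w z = 0"
    using equal_angle_poly_zero[OF z(2) w(2)] norm by simp
  then show False using ne w(1) by (auto simp: W_def)
qed

lemma congruent_sets_sym:
  assumes "congruent_sets A B"
  shows "congruent_sets B A"
proof -
  from assms obtain \<phi> where \<phi>: "orthogonal_transformation \<phi>" "\<phi> ` A = B" by (auto simp: congruent_sets_def)
  have "inv \<phi> ` B = A" using \<phi> orthogonal_transformation_inj[OF \<phi>(1)] by (auto simp: image_inv_f_f)
  then show ?thesis
    using orthogonal_transformation_inv[OF \<phi>(1)] by (auto simp: congruent_sets_def)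
qed

theorem theorem2:
  fixes P Q :: "'a::euclidean_space set" and r :: real
  assumes "DIM('a) \<ge> 3"
    and "r > 0"
    and "convex_polytope P" and "convex_polytope Q"
    and "P \<subseteq> interior (cball 0 r)" and "Q \<subseteq> interior (cball 0 r)"
    and "\<And>z. z \<in> sphere 0 r \<Longrightarrow>
           congruent_sets (spherical_projection r P z) (spherical_projection r Q z)"
  shows "P = Q"
proof -
  have PQ: "P \<subseteq> ball 0 r" "Q \<subseteq> ball 0 r" using assms(5,6) by (simp_all add: interior_cball)
  have "{v. v extreme_point_of P} = {v. v extreme_point_of Q}"
    using extreme_points_subset[OF assms(1-3) PQ(1) assms(4) PQ(2) assms(7)]
      extreme_points_subset[OF assms(1,2,4) PQ(2) assms(3) PQ(1) congruent_sets_sym[OF assms(7)]]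
    by blast
  moreover have "K = convex hull {v. v extreme_point_of K}" if "convex_polytope K" for K :: "'a set"
    using Krein_Milman_Minkowski[of K] that polytope_imp_compact polytope_imp_convex
    by (auto simp: convex_polytope_def)
  ultimately show ?thesis using assms(3,4) by metis
qed

end
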